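(* For $\delta\ge1$ and vectors $\alpha=(\alpha_1,\dots,\alpha_m)$, $\beta=(\beta_1,\dots,\beta_{m'})$ with $|\beta|\ge\delta$, the following polynomial identities hold for the relative node polynomials: $$N_\delta(\alpha,0;\beta)=N_\delta(\alpha;\beta)\quad\text{and}\quad N_\delta(\alpha;\beta,0)=N_\delta(\alpha;\beta),$$ where $(\alpha,0)=(\alpha_1,\dots,\alpha_m,0)$ and $(\beta,0)=(\beta_1,\dots,\beta_{m'},0)$. Therefore, there exists a formal power series $N^\infty_\delta(\alpha;\beta)$ in infinitely many variables $\alpha_1,\alpha_2,\dots,\beta_1,\beta_2,\dots$ that specializes to all relative node polynomials under $\alpha_{m+1}=\alpha_{m+2}=\cdots=0$ and $\beta_{m'+1}=\beta_{m'+2}=\cdots=0$, for various $m,m'\ge1$.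
   Context: Sequences $\alpha,\beta$ consist of non-negative integers with finitely many non-zero entries (finite vectors are padded with zeros). Write $|\beta|=\beta_1+\beta_2+\cdots$, $\beta!=\beta_1!\,\beta_2!\cdots$, and $d=\sum_{i\ge1}i(\alpha_i+\beta_i)$. Relative Severi degree: fix a line $L\subset\mathbb{CP}^2$. $N^\delta_{\alpha,\beta}$ is the number of (possibly reducible) reduced nodal plane curves of degree $d$ with $\delta$ nodes, not containing $L$ and smooth at their points on $L$, that have tangency of order $i$ (local intersection multiplicity $i$) to $L$ at $\alpha_i$ fixed general points of $L$ (chosen in advance) and tangency of order $i$ to $L$ at $\beta_i$ further unconstrained points, for all $i\ge1$, and that pass through $\frac{d(d+1)}{2}-\delta+|\beta|$ generic points of $\mathbb{CP}^2$. Equivalently, it is the degree of the generalized Severi variety of Caporaso and Harris. Relative node polynomial: for $\delta\ge1$ and given numbers of variables $m,m'\ge1$, $N_\delta(\alpha;\beta)$ denotes the (unique) polynomial in $\alpha_1,\dots,\alpha_m,\beta_1,\dots,\beta_{m'}$ such that $N^\delta_{\alpha,\beta}=1^{\beta_1}2^{\beta_2}\cdots\frac{(|\beta|-\delta)!}{\beta!}N_\delta(\alpha;\beta)$ for all non-negative integer vectors $\alpha=(\alpha_1,\dots,\alpha_m)$, $\beta=(\beta_1,\dots,\beta_{m'})$ with $|\beta|\ge\delta$; such a polynomial exists. In $N_\delta(\alpha,0;\beta)$ the polynomial with $m+1$ variables $\alpha_i$ is meant, and in $N_\delta(\alpha;\beta,0)$ the one with $m'+1$ variables $\beta_i$. 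*)

theory Defs
  imports
    "HOL-Analysis.Finite_Cartesian_Product"
    "HOL-Library.Numeral_Type"
    "HOL-Library.Poly_Mapping"
    "HOL-Library.FuncSet"
    "HOL-Computational_Algebra.Polynomial"
    "HOL-Computational_Algebra.Squarefree"
    Complex_Main
begin

section \<open>Multivariate polynomials and power series\<close>

type_synonym 'v monom = "'v \<Rightarrow>\<^sub>0 nat"

type_synonym ('v, 'a) mpoly = "'v monom \<Rightarrow>\<^sub>0 'a"

text \<open>A formal power series, in possibly infinitely many variables, is an arbitrary family of
  coefficients indexed by the (finitely supported) monomials.\<close>

type_synonym ('v, 'a) mps = "'v monom \<Rightarrow> 'a"

definition Const :: "'a \<Rightarrow> ('v, 'a::zero) mpoly" where
  "Const a = Poly_Mapping.single 0 a"

definition Var :: "'v \<Rightarrow> ('v, 'a::zero_neq_one) mpoly" where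
  "Var v = Poly_Mapping.single (Poly_Mapping.single v 1) 1"

definition mpoly_vars :: "('v, 'a::zero) mpoly \<Rightarrow> 'v set" where
  "mpoly_vars p = (\<Union>\<mu>\<in>Poly_Mapping.keys p. Poly_Mapping.keys \<mu>)"

text \<open>Substitution of \<open>x v\<close> for each variable \<open>v\<close>, the coefficients being mapped to the target
  ring by \<open>h\<close>.\<close>

definition mpoly_eval ::
  "('a::zero \<Rightarrow> 'b::comm_semiring_1) \<Rightarrow> ('v \<Rightarrow> 'b) \<Rightarrow> ('v, 'a) mpoly \<Rightarrow> 'b" where
  "mpoly_eval h x p =
    (\<Sum>\<mu>\<in>Poly_Mapping.keys p. h (Poly_Mapping.lookup p \<mu>) *
       (\<Prod>v\<in>Poly_Mapping.keys \<mu>. x v ^ Poly_Mapping.lookup \<mu> v))"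

definition mpoly_deriv :: "'v \<Rightarrow> ('v, 'a::comm_semiring_1) mpoly \<Rightarrow> ('v, 'a) mpoly" where
  "mpoly_deriv v p =
    (\<Sum>\<mu>\<in>Poly_Mapping.keys p. Poly_Mapping.single (\<mu> - Poly_Mapping.single v 1)
       (of_nat (Poly_Mapping.lookup \<mu> v) * Poly_Mapping.lookup p \<mu>))"

definition set_var_zero :: "'v \<Rightarrow> ('v, 'a::comm_semiring_1) mpoly \<Rightarrow> ('v, 'a) mpoly" where
  "set_var_zero v = mpoly_eval Const (\<lambda>u. if u = v then 0 else Var u)"

text \<open>Setting all variables outside \<open>V\<close> to zero in a power series kills exactly the monomials
  that involve such a variable.\<close>

definition mps_specialize :: "'v set \<Rightarrow> ('v, 'a::zero) mps \<Rightarrow> ('v, 'a) mps" where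
  "mps_specialize V F = (\<lambda>\<mu>. if Poly_Mapping.keys \<mu> \<subseteq> V then F \<mu> else 0)"

section \<open>Plane curves\<close>

text \<open>Points of the projective plane are represented by non-zero vectors in complex 3-space
  (and by \<open>proj_point\<close>-classes where points have to be counted), plane curves by non-zero forms in three
  variables. A non-zero vector \<open>L\<close> is the line with equation
  \<open>L$1 * X$1 + L$2 * X$2 + L$3 * X$3 = 0\<close>.\<close>

definition proj_point :: "complex^3 \<Rightarrow> (complex^3) set" where
  "proj_point v = {a *s v | a. a \<noteq> 0}"

definition on_line :: "complex^3 \<Rightarrow> complex^3 \<Rightarrow> bool" where
  "on_line L v \<longleftrightarrow> (\<Sum>i\<in>UNIV. L$i * v$i) = 0"

type_synonym form = "(3, complex) mpoly"

definition value_at :: "form \<Rightarrow> complex^3 \<Rightarrow> complex" where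
  "value_at F v = mpoly_eval (\<lambda>a. a) (\<lambda>i. v$i) F"

definition homogeneous :: "nat \<Rightarrow> form \<Rightarrow> bool" where
  "homogeneous d F \<longleftrightarrow> (\<forall>\<mu>\<in>Poly_Mapping.keys F. (\<Sum>i\<in>UNIV. Poly_Mapping.lookup \<mu> i) = d)"

definition singular_at :: "form \<Rightarrow> complex^3 \<Rightarrow> bool" where
  "singular_at F v \<longleftrightarrow> value_at F v = 0 \<and> (\<forall>i. value_at (mpoly_deriv i F) v = 0)"

text \<open>A node is a singular point with non-degenerate Hessian. In homogeneous coordinates the
  Hessian form at a singular point \<open>v\<close> always has \<open>v\<close> in its kernel and descends to the tangent
  space, i.e. (up to a twist) the quotient of complex 3-space by \<open>v\<close>; it is non-degenerate there
  iff the kernel consists of the multiples of \<open>v\<close> only.\<close>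

definition node_at :: "form \<Rightarrow> complex^3 \<Rightarrow> bool" where
  "node_at F v \<longleftrightarrow> singular_at F v \<and>
    (\<forall>w. (\<forall>i. (\<Sum>j\<in>UNIV. value_at (mpoly_deriv i (mpoly_deriv j F)) v * w$j) = 0)
          \<longrightarrow> (\<exists>a. w = a *s v))"

text \<open>The local intersection multiplicity of the curve \<open>F\<close> with the line \<open>L\<close> at the point \<open>v\<close> of
  \<open>L\<close> is the order of vanishing at \<open>v\<close> of the restriction of \<open>F\<close> to \<open>L\<close>, i.e. the order at
  \<open>t = 0\<close> of \<open>F (v + t w)\<close>, where \<open>w\<close> is any other point of \<open>L\<close> (the order does not depend on
  the choice of \<open>w\<close>). It is only used for curves that do not contain \<open>L\<close>.\<close>

definition intersection_mult_is ::
  "complex^3 \<Rightarrow> form \<Rightarrow> complex^3 \<Rightarrow> nat \<Rightarrow> bool" where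
  "intersection_mult_is L F v k \<longleftrightarrow>
    (\<forall>w. on_line L w \<and> (\<nexists>a. w = a *s v) \<longrightarrow>
      order 0 (mpoly_eval (\<lambda>a. [:a:]) (\<lambda>i. [:v$i, w$i:]) F) = k)"

section \<open>Relative Severi degrees\<close>

text \<open>Sequences \<open>\<alpha>\<close>, \<open>\<beta>\<close> are indexed from 1: they are only used with
  \<open>Poly_Mapping.keys \<alpha> \<subseteq> {1..}\<close>, and a vector of length \<open>m\<close> is a sequence with
  \<open>Poly_Mapping.keys \<alpha> \<subseteq> {1..m}\<close>.\<close>

type_synonym tangency = "nat \<Rightarrow>\<^sub>0 nat"

definition size_of :: "tangency \<Rightarrow> nat" where
  "size_of \<beta> = (\<Sum>i\<in>Poly_Mapping.keys \<beta>. Poly_Mapping.lookup \<beta> i)"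

definition fact_of :: "tangency \<Rightarrow> nat" where
  "fact_of \<beta> = (\<Prod>i\<in>Poly_Mapping.keys \<beta>. fact (Poly_Mapping.lookup \<beta> i))"

definition mult_of :: "tangency \<Rightarrow> nat" where
  "mult_of \<beta> = (\<Prod>i\<in>Poly_Mapping.keys \<beta>. i ^ Poly_Mapping.lookup \<beta> i)"

definition degree_of :: "tangency \<Rightarrow> tangency \<Rightarrow> nat" where
  "degree_of \<alpha> \<beta> = (\<Sum>i\<in>Poly_Mapping.keys (\<alpha> + \<beta>).
     i * (Poly_Mapping.lookup \<alpha> i + Poly_Mapping.lookup \<beta> i))"

text \<open>The subtraction does not truncate for \<open>\<delta> \<le> size_of \<beta>\<close>, the only range in which relative
  node polynomials refer to it.\<close>

definition num_points :: "nat \<Rightarrow> tangency \<Rightarrow> tangency \<Rightarrow> nat" where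
  "num_points \<delta> \<alpha> \<beta> =
    (let d = degree_of \<alpha> \<beta> in d * (d + 1) div 2 + size_of \<beta> - \<delta>)"

text \<open>A point configuration consists of the fixed points \<open>c (Inl (i, j))\<close> on \<open>L\<close>, where
  \<open>j < \<alpha>\<^sub>i\<close> and tangency of order \<open>i\<close> is prescribed, and of the points \<open>c (Inr k)\<close> of the plane.\<close>

type_synonym config = "(nat \<times> nat) + nat \<Rightarrow> complex^3"

definition fixed_index :: "tangency \<Rightarrow> (nat \<times> nat) set" where
  "fixed_index \<alpha> = (SIGMA i:Poly_Mapping.keys \<alpha>. {..<Poly_Mapping.lookup \<alpha> i})"

definition configs :: "complex^3 \<Rightarrow> nat \<Rightarrow> tangency \<Rightarrow> tangency \<Rightarrow> config set" where
  "configs L \<delta> \<alpha> \<beta> =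
    PiE (fixed_index \<alpha> <+> {..<num_points \<delta> \<alpha> \<beta>})
      (case_sum (\<lambda>_. {v. v \<noteq> 0 \<and> on_line L v}) (\<lambda>_. {v. v \<noteq> 0}))"

text \<open>A property holds generically if it holds on a non-empty Zariski open subset of the
  (irreducible) configuration space; it suffices to consider complements of hypersurfaces.\<close>

definition generically :: "config set \<Rightarrow> (config \<Rightarrow> bool) \<Rightarrow> bool" where
  "generically S P \<longleftrightarrow>
    (\<exists>G :: (((nat \<times> nat) + nat) \<times> 3, complex) mpoly.
       (\<exists>c\<in>S. mpoly_eval (\<lambda>a. a) (\<lambda>(k, i). c k $ i) G \<noteq> 0) \<and>
       (\<forall>c\<in>S. mpoly_eval (\<lambda>a. a) (\<lambda>(k, i). c k $ i) G \<noteq> 0 \<longrightarrow> P c))"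

definition severi_forms ::
  "complex^3 \<Rightarrow> nat \<Rightarrow> tangency \<Rightarrow> tangency \<Rightarrow> config \<Rightarrow> form set" where
  "severi_forms L \<delta> \<alpha> \<beta> c = {F.
     F \<noteq> 0 \<and> homogeneous (degree_of \<alpha> \<beta>) F \<and> squarefree F \<and>
     (\<comment> \<open>nodal with \<open>\<delta>\<close> nodes\<close>
       (\<forall>v. v \<noteq> 0 \<and> singular_at F v \<longrightarrow> node_at F v) \<and>
       finite {proj_point v | v. v \<noteq> 0 \<and> node_at F v} \<and>
       card {proj_point v | v. v \<noteq> 0 \<and> node_at F v} = \<delta>) \<and>
     (\<comment> \<open>not containing \<open>L\<close>, smooth along \<open>L\<close>\<close>
       (\<exists>v. on_line L v \<and> value_at F v \<noteq> 0) \<and>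
       (\<forall>v. v \<noteq> 0 \<and> on_line L v \<longrightarrow> \<not> singular_at F v)) \<and>
     (\<comment> \<open>tangencies at the fixed points\<close>
       \<forall>(i, j)\<in>fixed_index \<alpha>. intersection_mult_is L F (c (Inl (i, j))) i) \<and>
     (\<comment> \<open>tangencies at further points\<close>
       \<forall>i\<ge>1. card {proj_point v | v. v \<noteq> 0 \<and> on_line L v \<and> intersection_mult_is L F v i \<and>
                      (\<forall>p\<in>fixed_index \<alpha>. proj_point v \<noteq> proj_point (c (Inl p)))}
              = Poly_Mapping.lookup \<beta> i) \<and>
     (\<comment> \<open>passing through the points of the plane\<close>
       \<forall>k<num_points \<delta> \<alpha> \<beta>. value_at F (c (Inr k)) = 0)}"

text \<open>Since the curves are reduced, a curve is a form up to non-zero scalars.\<close>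

definition severi_curves ::
  "complex^3 \<Rightarrow> nat \<Rightarrow> tangency \<Rightarrow> tangency \<Rightarrow> config \<Rightarrow> form set set" where
  "severi_curves L \<delta> \<alpha> \<beta> c =
    (\<lambda>F. {Const a * F | a. a \<noteq> 0}) ` severi_forms L \<delta> \<alpha> \<beta> c"

definition relative_severi_degree ::
  "complex^3 \<Rightarrow> nat \<Rightarrow> tangency \<Rightarrow> tangency \<Rightarrow> nat" where
  "relative_severi_degree L \<delta> \<alpha> \<beta> =
    (THE N. generically (configs L \<delta> \<alpha> \<beta>)
       (\<lambda>c. finite (severi_curves L \<delta> \<alpha> \<beta> c) \<and> card (severi_curves L \<delta> \<alpha> \<beta> c) = N))"

section \<open>Relative node polynomials\<close>

datatype node_var = Alpha nat | Beta nat

definition node_vars :: "nat \<Rightarrow> nat \<Rightarrow> node_var set" where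
  "node_vars m m' = Alpha ` {1..m} \<union> Beta ` {1..m'}"

text \<open>\<open>P\<close> is the polynomial \<open>N\<^sub>\<delta>\<close> in the variables \<open>\<alpha>\<^sub>1, \<dots>, \<alpha>\<^sub>m, \<beta>\<^sub>1, \<dots>, \<beta>\<^sub>m\<^sub>'\<close>. The defining
  property determines \<open>P\<close> uniquely.\<close>

definition is_relative_node_poly ::
  "complex^3 \<Rightarrow> nat \<Rightarrow> nat \<Rightarrow> nat \<Rightarrow> (node_var, rat) mpoly \<Rightarrow> bool" where
  "is_relative_node_poly L \<delta> m m' P \<longleftrightarrow>
    mpoly_vars P \<subseteq> node_vars m m' \<and>
    (\<forall>\<alpha> \<beta>. Poly_Mapping.keys \<alpha> \<subseteq> {1..m} \<and> Poly_Mapping.keys \<beta> \<subseteq> {1..m'} \<and> \<delta> \<le> size_of \<beta> \<longrightarrow>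
      of_nat (relative_severi_degree L \<delta> \<alpha> \<beta>) =
        of_nat (mult_of \<beta>) * (fact (size_of \<beta> - \<delta>) / of_nat (fact_of \<beta>)) *
        mpoly_eval (\<lambda>a. a)
          (case_node_var (\<lambda>i. of_nat (Poly_Mapping.lookup \<alpha> i))
                         (\<lambda>i. of_nat (Poly_Mapping.lookup \<beta> i))) P)"

end

theory Submission
  imports Defs
begin

text \<open>A relative node polynomial is prescribed, through a non-zero factor, on all lattice points
  with coordinates at least \<open>\<delta>\<close>; these are Zariski dense, so the polynomial is unique. Truncating
  the variables of a relative node polynomial amounts to restricting the defining property to
  shorter vectors, so it yields the relative node polynomial in fewer variables. The formal power
  series then collects the coefficients, which do not depend on the number of variables.\<close>

section \<open>Polynomials vanishing on an infinite grid\<close>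

text \<open>The exponent vectors \<open>e \<mu>\<close> need only be distinct on \<open>V\<close>: this lets the induction pass to the
  terms of fixed degree in one variable.\<close>

lemma grid_sum_zero_imp_coeff_zero:
  fixes c :: "'m \<Rightarrow> 'a::idom" and e :: "'m \<Rightarrow> 'v \<Rightarrow> nat" and S :: "'a set"
  assumes "finite V" "infinite S" "finite A"
    and "\<And>\<mu> \<nu>. \<mu> \<in> A \<Longrightarrow> \<nu> \<in> A \<Longrightarrow> (\<And>v. v \<in> V \<Longrightarrow> e \<mu> v = e \<nu> v) \<Longrightarrow> \<mu> = \<nu>"
    and "\<And>x. (\<And>v. v \<in> V \<Longrightarrow> x v \<in> S) \<Longrightarrow> (\<Sum>\<mu>\<in>A. c \<mu> * (\<Prod>v\<in>V. x v ^ e \<mu> v)) = 0"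
    and "\<mu> \<in> A"
  shows "c \<mu> = 0"
  using assms(1,3-)
proof (induction V arbitrary: A \<mu> rule: finite_induct)
  case empty
  \<comment> \<open>With no variables all exponent vectors agree, so injectivity leaves only one
    term, and the value of \<open>x\<close> is irrelevant.\<close>
  have "A = {\<mu>}" using empty.prems(2,4) by blast
  then show ?case using empty.prems(3)[of "\<lambda>_. undefined"] by simp
next
  case (insert v V)
  \<comment> \<open>The terms having the same degree in \<open>v\<close> as \<open>\<mu>\<close>.
    Since they agree at \<open>v\<close>, their exponents are still distinct on the smaller
    \<open>V\<close>, as the induction hypothesis demands.\<close>
  define B where "B = {\<nu>\<in>A. e \<nu> v = e \<mu> v}"
  have sum_B: "(\<Sum>\<nu>\<in>B. c \<nu> * (\<Prod>u\<in>V. x u ^ e \<nu> u)) = 0"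
    if x: "\<And>u. u \<in> V \<Longrightarrow> x u \<in> S" for x
  proof -
    \<comment> \<open>Freeze the coordinates in \<open>V\<close> and view the sum as a univariate
      polynomial in the coordinate \<open>v\<close>. It has infinitely many roots, so it is zero;
      its coefficient at \<open>e \<mu> v\<close> is the sum over \<open>B\<close>.\<close>
    define q where "q = (\<Sum>\<nu>\<in>A. monom (c \<nu> * (\<Prod>u\<in>V. x u ^ e \<nu> u)) (e \<nu> v))"
    have "poly q t = 0" if "t \<in> S" for t
    proof -
      have "poly q t = (\<Sum>\<nu>\<in>A. c \<nu> * (\<Prod>u\<in>insert v V. (x(v := t)) u ^ e \<nu> u))"
        unfolding q_def poly_sum
      proof (intro sum.cong refl)
        fix \<nu>
        have "(\<Prod>u\<in>V. (x(v := t)) u ^ e \<nu> u) = (\<Prod>u\<in>V. x u ^ e \<nu> u)"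
          using insert.hyps by (intro prod.cong) auto
        then show "poly (monom (c \<nu> * (\<Prod>u\<in>V. x u ^ e \<nu> u)) (e \<nu> v)) t =
            c \<nu> * (\<Prod>u\<in>insert v V. (x(v := t)) u ^ e \<nu> u)"
          using insert.hyps by (simp add: poly_monom mult_ac)
      qed
      also have "\<dots> = 0" using x that by (intro insert.prems(3)) auto
      finally show ?thesis .
    qed
    then have "S \<subseteq> {t. poly q t = 0}" by blast
    then have "q = 0" using \<open>infinite S\<close> poly_roots_finite finite_subset by blast
    then have "coeff q (e \<mu> v) = 0" by simp
    then show ?thesis
      by (simp add: q_def coeff_sum B_def sum.inter_filter insert.prems(1))
  qed
  show ?case
  proof (rule insert.IH[of B])
    show "finite B" "\<mu> \<in> B" using insert.prems by (auto simp: B_def)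
    show "\<nu> = \<nu>'" if "\<nu> \<in> B" "\<nu>' \<in> B" "\<And>u. u \<in> V \<Longrightarrow> e \<nu> u = e \<nu>' u" for \<nu> \<nu>'
      using that by (intro insert.prems(2)) (auto simp: B_def)
  qed (rule sum_B)
qed

text \<open>Additional monomials have coefficient 0, which \<open>h\<close> preserves, and
  additional variables have exponent 0. This allows two polynomials to be evaluated over common
  index sets.\<close>

lemma mpoly_eval_superset:
  assumes "finite A" "Poly_Mapping.keys p \<subseteq> A" "finite V" "mpoly_vars p \<subseteq> V" "h 0 = 0"
  shows "mpoly_eval h x p =
    (\<Sum>\<mu>\<in>A. h (Poly_Mapping.lookup p \<mu>) * (\<Prod>v\<in>V. x v ^ Poly_Mapping.lookup \<mu> v))"
proof -
  have "mpoly_eval h x p = (\<Sum>\<mu>\<in>Poly_Mapping.keys p. h (Poly_Mapping.lookup p \<mu>) *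
      (\<Prod>v\<in>V. x v ^ Poly_Mapping.lookup \<mu> v))"
    unfolding mpoly_eval_def
  proof (intro sum.cong refl arg_cong2[where f = "(*)"] prod.mono_neutral_left ballI)
    fix \<mu> assume "\<mu> \<in> Poly_Mapping.keys p"
    then show "Poly_Mapping.keys \<mu> \<subseteq> V" using assms(4) by (auto simp: mpoly_vars_def)
  qed (use assms(3) in \<open>auto simp: in_keys_iff\<close>)
  also have "\<dots> = (\<Sum>\<mu>\<in>A. h (Poly_Mapping.lookup p \<mu>) *
      (\<Prod>v\<in>V. x v ^ Poly_Mapping.lookup \<mu> v))"
    using assms by (intro sum.mono_neutral_left) (auto simp: in_keys_iff)
  finally show ?thesis .
qed

lemma finite_mpoly_vars: "finite (mpoly_vars p)"
  by (simp add: mpoly_vars_def)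

lemma mpoly_eqI_grid:
  fixes p q :: "('v, 'a::idom) mpoly"
  assumes "finite V" "infinite S" and vars: "mpoly_vars p \<subseteq> V" "mpoly_vars q \<subseteq> V"
    and eq: "\<And>x. (\<And>v. v \<in> V \<Longrightarrow> x v \<in> S) \<Longrightarrow> mpoly_eval (\<lambda>a. a) x p = mpoly_eval (\<lambda>a. a) x q"
  shows "p = q"
proof (rule poly_mapping_eqI)
  fix \<mu>
  define A where "A = Poly_Mapping.keys p \<union> Poly_Mapping.keys q"
  have fin: "finite A" by (simp add: A_def)
  have keys_V: "Poly_Mapping.keys \<nu> \<subseteq> V" if "\<nu> \<in> A" for \<nu>
    using that vars by (auto simp: A_def mpoly_vars_def)
  show "Poly_Mapping.lookup p \<mu> = Poly_Mapping.lookup q \<mu>"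
  proof (cases "\<mu> \<in> A")
    case True
    have "Poly_Mapping.lookup p \<mu> - Poly_Mapping.lookup q \<mu> = 0"
    proof (rule grid_sum_zero_imp_coeff_zero[where e = Poly_Mapping.lookup and A = A
          and c = "\<lambda>\<nu>. Poly_Mapping.lookup p \<nu> - Poly_Mapping.lookup q \<nu>", OF assms(1,2) fin _ _ True])
      fix \<nu> \<nu>' assume "\<nu> \<in> A" "\<nu>' \<in> A"
        and "\<And>v. v \<in> V \<Longrightarrow> Poly_Mapping.lookup \<nu> v = Poly_Mapping.lookup \<nu>' v"
      \<comment> \<open>Monomials in \<open>A\<close> have exponent 0 outside \<open>V\<close>, so
        agreement on \<open>V\<close> is agreement everywhere.\<close>
      then show "\<nu> = \<nu>'"
        using keys_V by (intro poly_mapping_eqI) (metis in_keys_iff subsetD)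
    next
      fix x assume "\<And>v. v \<in> V \<Longrightarrow> x v \<in> S"
      then show "(\<Sum>\<nu>\<in>A. (Poly_Mapping.lookup p \<nu> - Poly_Mapping.lookup q \<nu>) *
          (\<Prod>v\<in>V. x v ^ Poly_Mapping.lookup \<nu> v)) = 0"
        using eq[of x] mpoly_eval_superset[OF fin _ assms(1) vars(1), of "\<lambda>a. a" x]
          mpoly_eval_superset[OF fin _ assms(1) vars(2), of "\<lambda>a. a" x]
        by (simp add: A_def left_diff_distrib sum_subtractf)
    qed
    then show ?thesis by simp
  next
    case False
    then show ?thesis by (simp add: A_def in_keys_iff)
  qed
qed

section \<open>Setting variables to zero\<close>

text \<open>Generalises \<open>set_var_zero\<close> to any set of variables to be killed, so that
  passing from many variables to few is a single substitution.\<close>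

definition restrict_vars :: "'v set \<Rightarrow> ('v, 'a::comm_semiring_1) mpoly \<Rightarrow> ('v, 'a) mpoly" where
  "restrict_vars V = mpoly_eval Const (\<lambda>u. if u \<in> V then Var u else 0)"

lemma set_var_zero_eq_restrict_vars: "set_var_zero v = restrict_vars (- {v})"
  by (auto simp: set_var_zero_def restrict_vars_def intro!: arg_cong[where f = "mpoly_eval Const"])

lemma Var_power: "Var v ^ n = (Poly_Mapping.single (Poly_Mapping.single v n) 1 :: ('v, 'a::comm_semiring_1) mpoly)"
  by (induction n) (simp_all add: Var_def mult_single single_add[symmetric])

lemma prod_Var_power:
  assumes "finite A"
  shows "(\<Prod>v\<in>A. Var v ^ f v) =
    (Poly_Mapping.single (\<Sum>v\<in>A. Poly_Mapping.single v (f v)) 1 :: ('v, 'a::comm_semiring_1) mpoly)"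
  using assms by (induction A rule: finite_induct) (simp_all add: Var_power mult_single)

lemma prod_Var_power_monom:
  "(\<Prod>v\<in>Poly_Mapping.keys \<mu>. Var v ^ Poly_Mapping.lookup \<mu> v) =
    (Poly_Mapping.single \<mu> 1 :: ('v, 'a::comm_semiring_1) mpoly)"
proof -
  have "(\<Sum>v\<in>Poly_Mapping.keys \<mu>. Poly_Mapping.single v (Poly_Mapping.lookup \<mu> v)) = \<mu>"
    by (rule poly_mapping_eqI) (simp add: lookup_sum lookup_single when_def in_keys_iff)
  then show ?thesis by (simp add: prod_Var_power)
qed

text \<open>The substitution fixes a monomial in the variables \<open>V\<close> and kills any other,
  which acquires a factor 0 with positive exponent. Hence truncation by substitution has the same
  effect on coefficients as \<open>mps_specialize\<close>.\<close>

lemma lookup_restrict_vars: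
  fixes p :: "('v, 'a::comm_semiring_1) mpoly"
  shows "Poly_Mapping.lookup (restrict_vars V p) \<mu> =
    (if Poly_Mapping.keys \<mu> \<subseteq> V then Poly_Mapping.lookup p \<mu> else 0)"
proof -
  have term_eq: "Const a * (\<Prod>v\<in>Poly_Mapping.keys \<nu>.
      (if v \<in> V then Var v else 0) ^ Poly_Mapping.lookup \<nu> v) =
      Poly_Mapping.single \<nu> (if Poly_Mapping.keys \<nu> \<subseteq> V then a else 0)" for a :: 'a and \<nu>
  proof (cases "Poly_Mapping.keys \<nu> \<subseteq> V")
    case True
    then have "(\<Prod>v\<in>Poly_Mapping.keys \<nu>. (if v \<in> V then Var v else 0) ^ Poly_Mapping.lookup \<nu> v) =
        (\<Prod>v\<in>Poly_Mapping.keys \<nu>. Var v ^ Poly_Mapping.lookup \<nu> v :: ('v, 'a) mpoly)"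
      by (intro prod.cong) auto
    then show ?thesis
      using True by (simp add: prod_Var_power_monom Const_def mult_single)
  next
    case False
    then obtain v where "v \<in> Poly_Mapping.keys \<nu>" "v \<notin> V" by blast
    then have "(\<Prod>v\<in>Poly_Mapping.keys \<nu>. (if v \<in> V then Var v else 0) ^ Poly_Mapping.lookup \<nu> v) =
        (0 :: ('v, 'a) mpoly)"
      by (intro prod_zero bexI[of _ v]) (auto simp: in_keys_iff zero_power)
    then show ?thesis using False by simp
  qed
  have "Poly_Mapping.lookup (restrict_vars V p) \<mu> =
      (\<Sum>\<nu>\<in>Poly_Mapping.keys p. if \<nu> = \<mu> then
        (if Poly_Mapping.keys \<mu> \<subseteq> V then Poly_Mapping.lookup p \<mu> else 0) else 0)"
    unfolding restrict_vars_def mpoly_eval_def term_eq lookup_sum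
    by (intro sum.cong) (auto simp: lookup_single when_def)
  then show ?thesis by (simp add: in_keys_iff)
qed

lemma mpoly_vars_restrict_vars: "mpoly_vars (restrict_vars V p) \<subseteq> V \<inter> mpoly_vars p"
proof -
  have "Poly_Mapping.keys (restrict_vars V p) =
      {\<mu> \<in> Poly_Mapping.keys p. Poly_Mapping.keys \<mu> \<subseteq> V}"
    by (rule set_eqI) (simp add: in_keys_iff lookup_restrict_vars)
  then show ?thesis unfolding mpoly_vars_def by blast
qed

text \<open>Only variables occurring in \<open>p\<close> matter. This is what turns killing one
  variable into keeping a set \<open>node_vars m m'\<close>.\<close>

lemma restrict_vars_cong:
  assumes "V \<inter> mpoly_vars p = W \<inter> mpoly_vars p"
  shows "restrict_vars V p = restrict_vars W p"
proof (rule poly_mapping_eqI)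
  fix \<mu>
  have "Poly_Mapping.keys \<mu> \<subseteq> V \<longleftrightarrow> Poly_Mapping.keys \<mu> \<subseteq> W" if "\<mu> \<in> Poly_Mapping.keys p"
    using that assms by (auto simp: mpoly_vars_def)
  then show "Poly_Mapping.lookup (restrict_vars V p) \<mu> = Poly_Mapping.lookup (restrict_vars W p) \<mu>"
    by (auto simp: lookup_restrict_vars in_keys_iff)
qed

lemma mpoly_eval_restrict_vars:
  assumes "h 0 = 0" "\<And>v. v \<in> mpoly_vars p \<Longrightarrow> v \<notin> V \<Longrightarrow> x v = 0"
  shows "mpoly_eval h x (restrict_vars V p) = mpoly_eval h x p"
proof -
  let ?U = "mpoly_vars p" and ?K = "Poly_Mapping.keys p"
  have sub: "Poly_Mapping.keys (restrict_vars V p) \<subseteq> ?K"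
    by (auto simp: in_keys_iff lookup_restrict_vars split: if_splits)
  have vars: "mpoly_vars (restrict_vars V p) \<subseteq> ?U"
    using mpoly_vars_restrict_vars by (rule order_trans) simp
  \<comment> \<open>A discarded monomial contains a variable outside \<open>V\<close>, where
    \<open>x\<close> is 0, so it contributes nothing to the value of \<open>p\<close>
    either.\<close>
  have vanish: "(\<Prod>v\<in>?U. x v ^ Poly_Mapping.lookup \<mu> v) = 0"
    if \<mu>: "\<mu> \<in> ?K" "\<not> Poly_Mapping.keys \<mu> \<subseteq> V" for \<mu>
  proof -
    obtain v where v: "v \<in> Poly_Mapping.keys \<mu>" "v \<notin> V" using \<mu> by blast
    then have "v \<in> ?U" using \<mu> by (auto simp: mpoly_vars_def)
    moreover have "x v ^ Poly_Mapping.lookup \<mu> v = 0"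
      using v \<open>v \<in> ?U\<close> assms(2) by (simp add: in_keys_iff zero_power)
    ultimately show ?thesis by (intro prod_zero finite_mpoly_vars bexI[of _ v])
  qed
  show ?thesis
    unfolding mpoly_eval_superset[where h = h, OF finite_keys[of p] sub finite_mpoly_vars[of p] vars assms(1)]
      mpoly_eval_superset[where h = h, OF finite_keys[of p] order_refl finite_mpoly_vars[of p] order_refl assms(1)]
    by (intro sum.cong refl) (auto simp: lookup_restrict_vars vanish)
qed

section \<open>Relative node polynomials\<close>

lemma finite_node_vars: "finite (node_vars m m')"
  by (simp add: node_vars_def)

lemma node_vars_Int:
  "node_vars m m' \<inter> node_vars k k' = node_vars (min m k) (min m' k')"
proof (rule set_eqI)
  show "v \<in> node_vars m m' \<inter> node_vars k k' \<longleftrightarrow> v \<in> node_vars (min m k) (min m' k')" for v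
    by (cases v) (auto simp: node_vars_def)
qed

lemma lookup_le_size_of: "Poly_Mapping.lookup \<beta> i \<le> size_of \<beta>"
proof (cases "i \<in> Poly_Mapping.keys \<beta>")
  case True
  then show ?thesis unfolding size_of_def by (intro member_le_sum) auto
qed (simp add: in_keys_iff)

lemma relative_node_poly_unique:
  assumes "m' \<ge> 1" and P: "is_relative_node_poly L \<delta> m m' P"
    and Q: "is_relative_node_poly L \<delta> m m' Q"
  shows "P = Q"
proof (rule mpoly_eqI_grid)
  show "finite (node_vars m m')" by (rule finite_node_vars)
  show "mpoly_vars P \<subseteq> node_vars m m'" "mpoly_vars Q \<subseteq> node_vars m m'"
    using P Q by (simp_all add: is_relative_node_poly_def)
  \<comment> \<open>Coordinates at least \<delta> keep the grid infinite and ensure that its points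
    come from sequences with \<open>\<delta> \<le> size_of \<beta>\<close>.\<close>
  show "infinite (of_nat ` {\<delta>..} :: rat set)"
    by (metis finite_imageD inj_on_of_nat infinite_Ici)
  fix x :: "node_var \<Rightarrow> rat"
  assume grid: "\<And>v. v \<in> node_vars m m' \<Longrightarrow> x v \<in> of_nat ` {\<delta>..}"
  then have "\<forall>v\<in>node_vars m m'. \<exists>n\<ge>\<delta>. x v = of_nat n" by fastforce
  then obtain n where n: "\<And>v. v \<in> node_vars m m' \<Longrightarrow> n v \<ge> \<delta> \<and> x v = of_nat (n v)"
    by metis
  define seq :: "nat \<Rightarrow> (nat \<Rightarrow> node_var) \<Rightarrow> tangency" where
    "seq l f = (\<Sum>i\<in>{1..l}. Poly_Mapping.single i (n (f i)))" for l f
  have lookup_seq: "Poly_Mapping.lookup (seq l f) i = (if i \<in> {1..l} then n (f i) else 0)" for l f i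
    by (simp add: seq_def lookup_sum lookup_single when_def)
  define \<alpha> \<beta> where "\<alpha> = seq m Alpha" and "\<beta> = seq m' Beta"
  \<comment> \<open>\<open>x\<close> is arbitrary outside the node variables, whereas
    \<open>y\<close> is 0 there, being built from tangency sequences. The two agree on all variables
    that \<open>P\<close> and \<open>Q\<close> can contain.\<close>
  define y :: "node_var \<Rightarrow> rat" where
    "y = case_node_var (\<lambda>i. of_nat (Poly_Mapping.lookup \<alpha> i)) (\<lambda>i. of_nat (Poly_Mapping.lookup \<beta> i))"
  have keys: "Poly_Mapping.keys \<alpha> \<subseteq> {1..m}" "Poly_Mapping.keys \<beta> \<subseteq> {1..m'}"
    by (auto simp: \<alpha>_def \<beta>_def in_keys_iff lookup_seq split: if_splits)
  \<comment> \<open>The single entry at index 1 already makes \<beta> large enough; it exists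
    because \<open>m' \<ge> 1\<close>.\<close>
  have "\<delta> \<le> Poly_Mapping.lookup \<beta> 1"
    using n[of "Beta 1"] \<open>m' \<ge> 1\<close> by (simp add: \<beta>_def lookup_seq node_vars_def)
  also have "\<dots> \<le> size_of \<beta>" by (rule lookup_le_size_of)
  finally have size: "\<delta> \<le> size_of \<beta>" .
  \<comment> \<open>Indices start at 1, so no base in \<open>mult_of \<beta>\<close> is 0 and the
    prefactor can be cancelled.\<close>
  have "mult_of \<beta> \<noteq> 0" "fact_of \<beta> \<noteq> 0"
    using keys by (auto simp: mult_of_def fact_of_def)
  then have factor: "of_nat (mult_of \<beta>) * (fact (size_of \<beta> - \<delta>) / of_nat (fact_of \<beta>)) \<noteq> (0 :: rat)"
    by simp
  have y_eq: "mpoly_eval (\<lambda>a. a) y P = mpoly_eval (\<lambda>a. a) y Q"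
    using P Q keys size factor mult_left_cancel unfolding is_relative_node_poly_def y_def
    by metis
  have "y v = x v" if "v \<in> node_vars m m'" for v
    using that n[OF that] by (auto simp: y_def \<alpha>_def \<beta>_def lookup_seq node_vars_def)
  then have "mpoly_eval (\<lambda>a. a) y R = mpoly_eval (\<lambda>a. a) x R"
    if "mpoly_vars R \<subseteq> node_vars m m'" for R
    using that unfolding mpoly_eval_def mpoly_vars_def
    by (intro sum.cong refl arg_cong2[where f = "(*)"] prod.cong) (auto simp: subset_iff)
  then show "mpoly_eval (\<lambda>a. a) x P = mpoly_eval (\<lambda>a. a) x Q"
    using y_eq P Q by (simp add: is_relative_node_poly_def)
qed

text \<open>A short vector is also a long one padded with zeros, and the Severi degree and the
  prefactor depend only on the sequences. The variables removed take the value 0 there, so the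
  defining equation is inherited.\<close>

lemma relative_node_poly_restrict_vars:
  assumes P: "is_relative_node_poly L \<delta> m m' P" and "k \<le> m" "k' \<le> m'"
  shows "is_relative_node_poly L \<delta> k k' (restrict_vars (node_vars k k') P)"
  unfolding is_relative_node_poly_def
proof (intro conjI allI impI)
  show "mpoly_vars (restrict_vars (node_vars k k') P) \<subseteq> node_vars k k'"
    using mpoly_vars_restrict_vars by (rule order_trans) simp
  fix \<alpha> \<beta> :: tangency
  assume a: "Poly_Mapping.keys \<alpha> \<subseteq> {1..k} \<and> Poly_Mapping.keys \<beta> \<subseteq> {1..k'} \<and> \<delta> \<le> size_of \<beta>"
  let ?x = "case_node_var (\<lambda>i. of_nat (Poly_Mapping.lookup \<alpha> i))
    (\<lambda>i. of_nat (Poly_Mapping.lookup \<beta> i)) :: node_var \<Rightarrow> rat"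
  have "mpoly_eval (\<lambda>a. a) ?x (restrict_vars (node_vars k k') P) = mpoly_eval (\<lambda>a. a) ?x P"
  proof (rule mpoly_eval_restrict_vars)
    fix v assume "v \<in> mpoly_vars P" "v \<notin> node_vars k k'"
    then show "?x v = 0"
      using a by (cases v) (auto simp: node_vars_def in_keys_iff subset_iff)
  qed simp
  moreover have "Poly_Mapping.keys \<alpha> \<subseteq> {1..m}" "Poly_Mapping.keys \<beta> \<subseteq> {1..m'}"
    using a assms(2,3) by fastforce+
  ultimately show "of_nat (relative_severi_degree L \<delta> \<alpha> \<beta>) =
      of_nat (mult_of \<beta>) * (fact (size_of \<beta> - \<delta>) / of_nat (fact_of \<beta>)) *
      mpoly_eval (\<lambda>a. a) ?x (restrict_vars (node_vars k k') P)"
    using P a unfolding is_relative_node_poly_def by metis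
qed

lemma relative_node_poly_eq_restrict_vars:
  assumes "k' \<ge> 1" "k \<le> m" "k' \<le> m'"
    and "is_relative_node_poly L \<delta> k k' P" "is_relative_node_poly L \<delta> m m' Q"
  shows "restrict_vars (node_vars k k') Q = P"
  by (rule relative_node_poly_unique[OF assms(1) relative_node_poly_restrict_vars[OF assms(5,2,3)] assms(4)])

text \<open>Truncating both polynomials to their common variables gives the same relative node
  polynomial, and the coefficient of \<open>\<mu>\<close> survives both truncations. This makes the
  coefficients of the power series well defined.\<close>

lemma lookup_relative_node_poly_unique:
  assumes "m' \<ge> 1" "k' \<ge> 1"
    and P: "is_relative_node_poly L \<delta> m m' P" and Q: "is_relative_node_poly L \<delta> k k' Q"
    and \<mu>: "Poly_Mapping.keys \<mu> \<subseteq> node_vars m m'" "Poly_Mapping.keys \<mu> \<subseteq> node_vars k k'"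
  shows "Poly_Mapping.lookup P \<mu> = Poly_Mapping.lookup Q \<mu>"
proof -
  let ?W = "node_vars (min m k) (min m' k')"
  have "is_relative_node_poly L \<delta> (min m k) (min m' k') (restrict_vars ?W Q)"
    using Q by (rule relative_node_poly_restrict_vars) auto
  then have "restrict_vars ?W P = restrict_vars ?W Q"
    using assms by (intro relative_node_poly_eq_restrict_vars[OF _ _ _ _ P]) auto
  moreover have "Poly_Mapping.keys \<mu> \<subseteq> ?W"
    using \<mu> by (simp flip: node_vars_Int)
  ultimately show ?thesis by (metis lookup_restrict_vars)
qed

theorem theorem1p2:
  fixes L :: "complex^3" and \<delta> :: nat
  assumes "L \<noteq> 0" and "\<delta> \<ge> 1"
  shows
    "(\<forall>m\<ge>1. \<forall>m'\<ge>1. \<forall>N N'.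
        is_relative_node_poly L \<delta> m m' N \<and> is_relative_node_poly L \<delta> (m + 1) m' N' \<longrightarrow>
        set_var_zero (Alpha (m + 1)) N' = N) \<and>
     (\<forall>m\<ge>1. \<forall>m'\<ge>1. \<forall>N N'.
        is_relative_node_poly L \<delta> m m' N \<and> is_relative_node_poly L \<delta> m (m' + 1) N' \<longrightarrow>
        set_var_zero (Beta (m' + 1)) N' = N) \<and>
     (\<exists>N_inf :: (node_var, rat) mps. \<forall>m\<ge>1. \<forall>m'\<ge>1. \<forall>N.
        is_relative_node_poly L \<delta> m m' N \<longrightarrow>
        mps_specialize (node_vars m m') N_inf = Poly_Mapping.lookup N)"
proof (intro conjI allI impI)
  fix m m' :: nat and N N'
  assume "m' \<ge> 1" and a: "is_relative_node_poly L \<delta> m m' N \<and> is_relative_node_poly L \<delta> (m + 1) m' N'"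
  \<comment> \<open>Among the variables allowed in \<open>N'\<close>, only
    \<open>Alpha (m + 1)\<close> lies outside \<open>node_vars m m'\<close>.\<close>
  have "set_var_zero (Alpha (m + 1)) N' = restrict_vars (node_vars m m') N'"
    unfolding set_var_zero_eq_restrict_vars
    using a by (intro restrict_vars_cong) (auto simp: is_relative_node_poly_def node_vars_def subset_iff image_iff le_Suc_eq)
  also have "\<dots> = N"
    using \<open>m' \<ge> 1\<close> a
    by (intro relative_node_poly_eq_restrict_vars[where m = "m + 1" and m' = m']) auto
  finally show "set_var_zero (Alpha (m + 1)) N' = N" .
next
  fix m m' :: nat and N N'
  assume "m' \<ge> 1" and a: "is_relative_node_poly L \<delta> m m' N \<and> is_relative_node_poly L \<delta> m (m' + 1) N'"
  have "set_var_zero (Beta (m' + 1)) N' = restrict_vars (node_vars m m') N'"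
    unfolding set_var_zero_eq_restrict_vars
    using a by (intro restrict_vars_cong) (auto simp: is_relative_node_poly_def node_vars_def subset_iff image_iff le_Suc_eq)
  also have "\<dots> = N"
    using \<open>m' \<ge> 1\<close> a
    by (intro relative_node_poly_eq_restrict_vars[where m = m and m' = "m' + 1"]) auto
  finally show "set_var_zero (Beta (m' + 1)) N' = N" .
next
  \<comment> \<open>The coefficient of \<open>\<mu>\<close> is read off from any relative node
    polynomial in enough variables to contain \<open>\<mu>\<close>. Where there is none,
    \<open>THE\<close> leaves it unspecified, but the claim only inspects a coefficient when
    \<open>N\<close> itself is a witness.\<close>
  define coeff_of where "coeff_of \<mu> c \<longleftrightarrow> (\<exists>m m' N. m' \<ge> 1 \<and> is_relative_node_poly L \<delta> m m' N \<and>
    Poly_Mapping.keys \<mu> \<subseteq> node_vars m m' \<and> c = Poly_Mapping.lookup N \<mu>)" for \<mu> c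
  have "mps_specialize (node_vars m m') (\<lambda>\<mu>. THE c. coeff_of \<mu> c) = Poly_Mapping.lookup N"
    if "m' \<ge> 1" and N: "is_relative_node_poly L \<delta> m m' N" for m m' N
  proof
    fix \<mu>
    show "mps_specialize (node_vars m m') (\<lambda>\<mu>. THE c. coeff_of \<mu> c) \<mu> = Poly_Mapping.lookup N \<mu>"
    proof (cases "Poly_Mapping.keys \<mu> \<subseteq> node_vars m m'")
      case True
      have "(THE c. coeff_of \<mu> c) = Poly_Mapping.lookup N \<mu>"
      proof (rule the_equality)
        show "coeff_of \<mu> (Poly_Mapping.lookup N \<mu>)"
          using that True unfolding coeff_of_def by blast
        show "c = Poly_Mapping.lookup N \<mu>" if "coeff_of \<mu> c" for c
          using that lookup_relative_node_poly_unique[OF _ \<open>m' \<ge> 1\<close> _ N _ True]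
          unfolding coeff_of_def by blast
      qed
      then show ?thesis using True by (simp add: mps_specialize_def)
    next
      case False
      \<comment> \<open>A monomial with a variable beyond those of \<open>N\<close> has coefficient
        0 on both sides.\<close>
      then have "\<mu> \<notin> Poly_Mapping.keys N"
        using N by (auto simp: is_relative_node_poly_def mpoly_vars_def)
      then show ?thesis using False by (simp add: mps_specialize_def in_keys_iff)
    qed
  qed
  then show "\<exists>N_inf :: (node_var, rat) mps. \<forall>m\<ge>1. \<forall>m'\<ge>1. \<forall>N.
      is_relative_node_poly L \<delta> m m' N \<longrightarrow>
      mps_specialize (node_vars m m') N_inf = Poly_Mapping.lookup N"
    by blast
qed

end
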